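(* Let $N\ge 3$ be an integer, let $0<p<1$, and suppose that $\zeta$ is uniformly distributed on $[0,1]$. Let $(\mathcal X(t))_{t\ge 0}$ be the $p$-contest process with $N$ points and replacement distribution $\zeta$, started from an arbitrary (possibly random) initial configuration $\mathcal X(0)$ of points of $[0,1]$. Then $\mathcal X'(t)\to 0$ almost surely as $t\to\infty$.
   Context: Unordered tuples are understood with repetitions (multisets). For $\mathcal X=\{x_1,\dots,x_N\}$ let $\mu_N=\frac1N\sum_{i=1}^N x_i$; the $p$-centre of mass is $p\mu_N$. The extreme point of $\mathcal X$ is the point of $\mathcal X$ farthest from $p\mu_N$ (it is the smallest or the largest point; in case of a tie between the left-most and the right-most point, either one is chosen with probability $1/2$). The core $\mathcal X'$ is the $(N-1)$-tuple obtained from $\mathcal X$ by removing (one copy of) the extreme point. The $p$-contest process: given $\mathcal X(t)$, set $\mathcal X(t+1)=\mathcal X'(t)\cup\{\zeta_{t+1}\}$, where $\zeta_1,\zeta_2,\dots$ are i.i.d. with the distribution of $\zeta$, independent of $\mathcal X(0)$. The notation $x_{(1)}(t)\le\dots\le x_{(N-1)}(t)$ denotes the points of the core $\mathcal X'(t)$ in non-decreasing order. $\mathcal X'(t)\to a$ means $x_{(i)}(t)\to a$ for all $i=1,\dots,N-1$. *)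

theory Defs
  imports "HOL-Probability.Probability" "HOL-Library.Multiset"
begin

definition mean_mset :: "real multiset \<Rightarrow> real" where
  "mean_mset X = sum_mset X / real (size X)"

definition p_centre :: "real \<Rightarrow> real multiset \<Rightarrow> real" where
  "p_centre p X = p * mean_mset X"

definition farthest_points :: "real \<Rightarrow> real multiset \<Rightarrow> real set" where
  "farthest_points p X =
     {x \<in> set_mset X. \<forall>y \<in> set_mset X. dist y (p_centre p X) \<le> dist x (p_centre p X)}"

text \<open>
  The farthest points are the smallest point, the largest point, or both
  (see \<open>farthest_points_subset\<close>). The Boolean \<open>b\<close> is therefore
  consulted only in case of a tie, where it selects the left-most or the right-most point.
\<close>

definition extreme_point :: "real \<Rightarrow> bool \<Rightarrow> real multiset \<Rightarrow> real" where
  "extreme_point p b X = (if b then Min (farthest_points p X) else Max (farthest_points p X))"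

definition core :: "real \<Rightarrow> bool \<Rightarrow> real multiset \<Rightarrow> real multiset" where
  "core p b X = X - {#extreme_point p b X#}"

lemma farthest_points_subset:
  "farthest_points p X \<subseteq> {Min (set_mset X), Max (set_mset X)}"
proof
  fix x assume x: "x \<in> farthest_points p X"
  let ?m = "Min (set_mset X)" and ?M = "Max (set_mset X)"
  from x have "x \<in># X" by (simp add: farthest_points_def)
  then have "?m \<in># X" "?M \<in># X" "?m \<le> x" "x \<le> ?M"
    by (auto intro!: Min_in Max_in)
  with x show "x \<in> {?m, ?M}"
    unfolding farthest_points_def dist_real_def
    by (smt (verit) insert_iff mem_Collect_eq)
qed

lemma farthest_points_nonempty:
  assumes "X \<noteq> {#}"
  shows "farthest_points p X \<noteq> {}"
proof -
  let ?d = "\<lambda>x. dist x (p_centre p X)"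
  have "Max (?d ` set_mset X) \<in> ?d ` set_mset X"
    using assms by (intro Max_in) auto
  then obtain x where "x \<in># X" "Max (?d ` set_mset X) = ?d x" by auto
  moreover have "?d y \<le> Max (?d ` set_mset X)" if "y \<in># X" for y
    using that by (intro Max_ge) auto
  ultimately have "x \<in> farthest_points p X"
    by (auto simp: farthest_points_def)
  then show ?thesis by blast
qed

lemma extreme_point_farthest:
  assumes "X \<noteq> {#}"
  shows "extreme_point p b X \<in> farthest_points p X"
proof -
  have "finite (farthest_points p X)"
    using farthest_points_subset by (rule finite_subset) simp
  then show ?thesis
    using farthest_points_nonempty[OF assms] by (auto simp: extreme_point_def)
qed

lemma extreme_point_in:
  assumes "X \<noteq> {#}"
  shows "extreme_point p b X \<in># X"
  using extreme_point_farthest[OF assms] by (simp add: farthest_points_def)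

text \<open>Arguments: \<open>p\<close>, the initial configuration, the replacements \<open>\<zeta>\<close>
  (of which \<open>\<zeta> 1, \<zeta> 2, \<dots>\<close> are used) and the tie-breaking choices.\<close>

primrec contest ::
  "real \<Rightarrow> real multiset \<Rightarrow> (nat \<Rightarrow> real) \<Rightarrow> (nat \<Rightarrow> bool) \<Rightarrow> nat \<Rightarrow> real multiset" where
  "contest p X0 z b 0 = X0"
| "contest p X0 z b (Suc t) = add_mset (z (Suc t)) (core p (b t) (contest p X0 z b t))"

definition contest_core ::
  "real \<Rightarrow> real multiset \<Rightarrow> (nat \<Rightarrow> real) \<Rightarrow> (nat \<Rightarrow> bool) \<Rightarrow> nat \<Rightarrow> real multiset" where
  "contest_core p X0 z b t = core p (b t) (contest p X0 z b t)"

text \<open>Order statistics are numbered from \<open>1\<close>.\<close>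

definition order_stat :: "nat \<Rightarrow> real multiset \<Rightarrow> real" where
  "order_stat i X = sorted_list_of_multiset X ! (i - 1)"

definition core_tendsto :: "nat \<Rightarrow> (nat \<Rightarrow> real multiset) \<Rightarrow> real \<Rightarrow> bool" where
  "core_tendsto N Y a \<longleftrightarrow> (\<forall>i\<in>{1..N - 1}. (\<lambda>t. order_stat i (Y t)) \<longlonglongrightarrow> a)"

text \<open>The usual \<open>\<sigma>\<close>-algebra on finite configurations of points,
  generated by the numbers of points in Borel sets.\<close>

definition mset_algebra :: "real multiset measure" where
  "mset_algebra =
     sigma UNIV {{X. size (filter_mset (\<lambda>x. x \<in> A) X) = n} | A n. A \<in> sets borel}"

text \<open>
  The random input of a contest with \<open>N\<close> points in \<open>S\<close> and replacement
  distribution \<open>D\<close>: the initial configuration, the i.i.d. replacements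
  \<open>\<zeta> 1, \<zeta> 2, \<dots>\<close> and fair coins for breaking ties, all mutually independent.
  Independence is stated for the generated \<open>\<sigma>\<close>-algebras, since
  \<open>indep_vars\<close> needs variables of a common type.
\<close>

datatype source = Initial | Replacement nat | Coin nat

locale contest_input = prob_space M
  for M :: "'a measure" and N :: nat and S :: "real set" and D :: "real measure"
    and X0 :: "'a \<Rightarrow> real multiset" and \<zeta> :: "nat \<Rightarrow> 'a \<Rightarrow> real" and coin :: "nat \<Rightarrow> 'a \<Rightarrow> bool" +
  assumes X0_measurable: "random_variable mset_algebra X0"
    and \<zeta>_measurable: "\<And>t. t \<ge> 1 \<Longrightarrow> random_variable borel (\<zeta> t)"
    and coin_measurable: "\<And>t. random_variable (count_space UNIV) (coin t)"
    and X0_size: "AE \<omega> in M. size (X0 \<omega>) = N"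
    and X0_range: "AE \<omega> in M. set_mset (X0 \<omega>) \<subseteq> S"
    and \<zeta>_distr: "\<And>t. t \<ge> 1 \<Longrightarrow> distr M borel (\<zeta> t) = D"
    and coin_distr: "\<And>t. distr M (count_space UNIV) (coin t) = measure_pmf (bernoulli_pmf (1/2))"
    and indep: "indep_sets
      (\<lambda>s. case s of
          Initial \<Rightarrow> sets (vimage_algebra (space M) X0 mset_algebra)
        | Replacement t \<Rightarrow> sets (vimage_algebra (space M) (\<zeta> t) borel)
        | Coin t \<Rightarrow> sets (vimage_algebra (space M) (coin t) (count_space UNIV)))
      ({Initial} \<union> Replacement ` {1..} \<union> range Coin)"

end

theory Submission
  imports Defs
begin

text \<open>
  Put \<open>k = N / p - 1\<close>, which exceeds \<open>N - 1\<close> because \<open>p < 1\<close>. For a core \<open>Y\<close> with \<open>n = N - 1\<close>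
  points the energy \<open>\<Sum>x\<^sup>2 - (\<Sum>x)\<^sup>2 / k\<close> is the minimum over \<open>c\<close> of
  \<open>\<Sum>(x - c)\<^sup>2 + (k - n) c\<^sup>2\<close>: the spread of the points together with \<open>k - n\<close> units of mass nailed
  to \<open>0\<close>. The extra mass is chosen so that the minimiser for all \<open>N\<close> points, with \<open>k + 1\<close> in place of
  \<open>k\<close>, is exactly the \<open>p\<close>-centre of mass. Hence exchanging the farthest point \<open>e\<close> for a new point
  \<open>z\<close> lowers the energy by a multiple of \<open>(e - c)\<^sup>2 - (z - c)\<^sup>2 \<ge> 0\<close> (lemma \<open>energy_exchange\<close>):
  the energy never increases, whatever the replacements and the tie-breaking choices are.

  If all points lie within \<open>r\<close> of \<open>c\<close>, then the spread is small, and so is \<open>c\<close>, because the mass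
  at \<open>0\<close> would otherwise pull the centre away from the points; thus the energy is at most a constant
  times \<open>r\<^sup>2\<close> (\<open>energy_le_farthest\<close>). Read backwards: while the energy is at least \<open>\<epsilon>\<close>, the
  extreme point is far from \<open>c\<close>, and a replacement close to the centre \<open>(\<Sum>x) / k\<close> of the core
  costs a fixed amount of energy (\<open>energy_core_step\<close>). The energy being nonnegative and monotone, it
  tends to \<open>0\<close> as soon as the replacements come arbitrarily close to the current centre infinitely
  often; and it dominates every \<open>x\<^sup>2\<close>, so that the core tends to \<open>0\<close>
  (\<open>core_tendsto_zero_if_hits\<close>).

  It remains to see that such hits occur infinitely often almost surely. The centre of the core is
  determined by the initial configuration, the coins and the earlier replacements, and lies in
  \<open>[0,1]\<close>. The next replacement is independent of all these and uniform, so whatever the past, it falls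
  into the same cell of a grid of mesh \<open>1 / J\<close> with probability at least \<open>1 / J\<close>. A conditional version
  of the second Borel-Cantelli lemma (\<open>infinitely_often_if_conditionally_likely\<close>) finishes the proof.
\<close>

section \<open>The energy of a core\<close>

text \<open>
  For a core of \<open>n\<close> points this is \<open>Min\<^sub>c (\<Sum>(x - c)\<^sup>2 + (k - n) c\<^sup>2)\<close>, attained at
  \<open>c = (\<Sum>x) / k\<close>.
\<close>

definition energy :: "real \<Rightarrow> real multiset \<Rightarrow> real" where
  "energy k Y = (\<Sum>x\<in>#Y. x\<^sup>2) - (sum_mset Y)\<^sup>2 / k"

lemma sum_mset_shift_squared:
  fixes Y :: "real multiset"
  shows "(\<Sum>x\<in>#Y. (x - a)\<^sup>2) = (\<Sum>x\<in>#Y. x\<^sup>2) - 2 * a * sum_mset Y + real (size Y) * a\<^sup>2"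
  by (induction Y) (auto simp: algebra_simps power2_eq_square)

lemma sum_mset_squared_le:
  fixes Y :: "real multiset"
  shows "(sum_mset Y)\<^sup>2 \<le> real (size Y) * (\<Sum>x\<in>#Y. x\<^sup>2)"
proof (cases "Y = {#}")
  case False
  then have n: "real (size Y) > 0"
    by (simp add: nonempty_has_size)
  define a where "a = sum_mset Y / real (size Y)"
  have "0 \<le> (\<Sum>x\<in>#Y. (x - a)\<^sup>2)"
    by (induction Y) auto
  also have "\<dots> = (\<Sum>x\<in>#Y. x\<^sup>2) - (sum_mset Y)\<^sup>2 / real (size Y)"
    unfolding sum_mset_shift_squared using n by (simp add: a_def field_simps power2_eq_square)
  finally show ?thesis
    using n by (simp add: field_simps)
qed simp

text \<open>
  By Cauchy-Schwarz the subtracted term is at most the fraction \<open>n / k < 1\<close> of \<open>\<Sum>x\<^sup>2\<close>. This is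
  where \<open>p < 1\<close> makes the energy control the distance to \<open>0\<close> and not only the spread.
\<close>

lemma square_le_energy:
  assumes k: "real (size Y) < k" and x: "x \<in># Y"
  shows "x\<^sup>2 \<le> k / (k - real (size Y)) * energy k Y"
proof -
  let ?Q = "\<Sum>x\<in>#Y. x\<^sup>2"
  have k0: "k > 0" using k by linarith
  have "(sum_mset Y)\<^sup>2 / k \<le> real (size Y) * ?Q / k"
    using sum_mset_squared_le[of Y] k0 by (intro divide_right_mono) auto
  then have "?Q * (k - real (size Y)) / k \<le> energy k Y"
    using k0 by (simp add: energy_def field_simps)
  then have "?Q \<le> k / (k - real (size Y)) * energy k Y"
    using k k0 by (simp add: field_simps)
  moreover have "x\<^sup>2 \<le> ?Q"
  proof -
    obtain Z where Y: "Y = add_mset x Z" using x by (meson multi_member_split)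
    have "0 \<le> (\<Sum>x\<in>#Z. x\<^sup>2)" by (induction Z) auto
    then show ?thesis by (simp add: Y)
  qed
  ultimately show ?thesis by simp
qed

lemma energy_nonneg:
  assumes "real (size Y) < k"
  shows "0 \<le> energy k Y"
proof (cases "Y = {#}")
  case False
  then obtain x where x: "x \<in># Y" by blast
  have "0 \<le> k / (k - real (size Y)) * energy k Y"
    using square_le_energy[OF assms x] by (meson order_trans zero_le_power2)
  moreover have "k / (k - real (size Y)) > 0"
    using assms by (intro divide_pos_pos) linarith+
  ultimately show ?thesis
    by (metis mult_le_cancel_left_pos mult_zero_right)
qed (simp add: energy_def)

text \<open>
  The update formula for a sum of squared deviations when one point is added (with the mass at
  \<open>0\<close> counted, the total mass grows from \<open>k\<close> to \<open>k + 1\<close>), written with the distance to the new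
  centre, since it is the new centre that decides which point is extreme.
\<close>

lemma energy_add_mset:
  assumes "k > 0"
  shows "energy (k + 1) (add_mset x Y)
    = energy k Y + (k + 1) / k * (x - sum_mset (add_mset x Y) / (k + 1))\<^sup>2"
proof -
  have "k + 1 \<noteq> 0" "k \<noteq> 0" using assms by auto
  then show ?thesis
    unfolding energy_def by (simp add: divide_simps) (simp add: algebra_simps power2_eq_square)
qed

text \<open>
  Adding \<open>z\<close> to the old core and adding \<open>e\<close> to the new one give the same multiset, hence the same
  centre \<open>c\<close>, so the previous lemma applies to both with a common left-hand side.
\<close>

lemma energy_exchange:
  assumes k: "k > 0" and e: "e \<in># add_mset z Y"
    and c: "c = sum_mset (add_mset z Y) / (k + 1)"
  shows "energy k (add_mset z Y - {#e#})
    = energy k Y - (k + 1) / k * ((e - c)\<^sup>2 - (z - c)\<^sup>2)"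
proof -
  let ?X = "add_mset z Y"
  have "energy (k + 1) ?X = energy k (?X - {#e#}) + (k + 1) / k * (e - c)\<^sup>2"
    using energy_add_mset[OF k, of e "?X - {#e#}"] by (simp only: insert_DiffM[OF e] c)
  moreover have "energy (k + 1) ?X = energy k Y + (k + 1) / k * (z - c)\<^sup>2"
    using energy_add_mset[OF k, of z Y] by (simp only: c)
  ultimately show ?thesis by (simp add: algebra_simps)
qed

text \<open>
  Test the minimum defining the energy with \<open>c\<close> itself. The spread is at most \<open>n r\<^sup>2\<close>. Moreover the
  pull of the mass at \<open>0\<close> balances that of the points, \<open>(k - n) c = (\<Sum>Y - n c) + (z - c)\<close>, and each
  of the \<open>n + 1\<close> points contributes at most \<open>r\<close> to the right-hand side.
\<close>

lemma energy_le_farthest: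
  fixes Y :: "real multiset"
  defines "n \<equiv> real (size Y)"
  assumes k: "n < k" and c: "c = sum_mset (add_mset z Y) / (k + 1)"
    and far: "\<And>x. x \<in># add_mset z Y \<Longrightarrow> \<bar>x - c\<bar> \<le> r"
  shows "energy k Y \<le> (n + (n + 1)\<^sup>2 / (k - n)) * r\<^sup>2"
proof -
  have n0: "0 \<le> n" by (simp add: n_def)
  have k0: "k > 0" using k n0 by linarith
  have r0: "0 \<le> r" using far[of z] by (simp add: order_trans[OF abs_ge_zero])
  define S where "S = sum_mset Y"
  define V where "V = (\<Sum>x\<in>#Y. (x - c)\<^sup>2)"
  have Vr: "V \<le> n * r\<^sup>2"
  proof -
    have "V \<le> (\<Sum>x\<in>#Y. r\<^sup>2)"
      unfolding V_def
    proof (rule sum_mset_mono)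
      fix x assume "x \<in># Y"
      then have "\<bar>x - c\<bar> \<le> \<bar>r\<bar>" using far[of x] r0 by simp
      then show "(x - c)\<^sup>2 \<le> r\<^sup>2" by (simp add: abs_le_square_iff)
    qed
    then show ?thesis by (simp add: n_def)
  qed
  have Veq: "V = (\<Sum>x\<in>#Y. x\<^sup>2) - 2 * c * S + n * c\<^sup>2"
    by (simp add: V_def sum_mset_shift_squared S_def n_def)
  have "(S - n * c)\<^sup>2 \<le> n * V"
  proof -
    have "(\<Sum>x\<in>#Y. x - c) = S - n * c"
      unfolding S_def n_def by (induction Y) (auto simp: algebra_simps)
    then show ?thesis
      using sum_mset_squared_le[of "image_mset (\<lambda>x. x - c) Y"]
      by (simp add: V_def n_def image_mset.compositionality comp_def)
  qed
  also have "\<dots> \<le> n * (n * r\<^sup>2)"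
    using Vr n0 by (rule mult_left_mono)
  also have "\<dots> = (n * r)\<^sup>2" by (simp add: power2_eq_square)
  finally have dev: "\<bar>S - n * c\<bar> \<le> n * r"
    using n0 r0 by (metis abs_le_square_iff abs_of_nonneg mult_nonneg_nonneg)
  have S: "S = k * c - (z - c)"
  proof -
    have "(k + 1) * c = S + z" using k0 by (simp add: c S_def)
    then show ?thesis by (simp add: algebra_simps)
  qed
  have "\<bar>(k - n) * c\<bar> = \<bar>(S - n * c) + (z - c)\<bar>"
    by (simp add: S algebra_simps)
  also have "\<dots> \<le> n * r + r"
    using dev far[of z] by (simp add: abs_triangle_ineq[THEN order_trans] add_mono)
  finally have "((k - n) * c)\<^sup>2 \<le> ((n + 1) * r)\<^sup>2"
    by (intro abs_le_square_iff[THEN iffD1]) (simp add: algebra_simps)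
  then have cc: "(k - n) * c\<^sup>2 \<le> (n + 1)\<^sup>2 / (k - n) * r\<^sup>2"
    using k by (simp add: field_simps power2_eq_square)
  \<comment> \<open>The gap between the value at \<open>c\<close> and the minimum is a square.\<close>
  have "0 \<le> (S - k * c)\<^sup>2 / k" using k0 by simp
  also have "(S - k * c)\<^sup>2 / k = S\<^sup>2 / k - 2 * c * S + k * c\<^sup>2"
    using k0 by (simp add: field_simps power2_eq_square)
  finally have "energy k Y \<le> V + (k - n) * c\<^sup>2"
    by (simp add: energy_def Veq S_def algebra_simps)
  then show ?thesis using Vr cc by (simp add: algebra_simps)
qed

section \<open>The energy along a contest\<close>

lemma size_core:
  assumes "X \<noteq> {#}"
  shows "size (core p b X) = size X - 1"
  using extreme_point_in[OF assms] by (simp add: core_def size_Diff_singleton)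

lemma size_contest:
  assumes "size X = N" and "N > 0"
  shows "size (contest p X z b t) = N"
proof (induction t)
  case (Suc t)
  then have "contest p X z b t \<noteq> {#}" using assms by auto
  then show ?case using Suc assms by (simp add: size_core)
qed (use assms in simp)

lemma size_contest_core:
  assumes "size X = N" and "N > 0"
  shows "size (contest_core p X z b t) = N - 1"
  unfolding contest_core_def
  using size_contest[OF assms, of p z b t] assms(2) by (subst size_core) auto

lemma contest_range:
  assumes "set_mset X \<subseteq> A" and "\<And>t. t \<ge> 1 \<Longrightarrow> z t \<in> A"
  shows "set_mset (contest p X z b t) \<subseteq> A"
proof (induction t)
  case (Suc t)
  then show ?case using assms(2)[of "Suc t"]
    by (auto simp: core_def dest: in_diffD)
qed (use assms in simp)

text \<open>
  The decrease is stated with the centre \<open>sum_mset Y / k\<close> of the old core, which does not depend on the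
  replacement \<open>z\<close>, so that later \<open>z\<close> is independent of it. Nothing is lost: adding \<open>z\<close> moves
  the centre towards \<open>z\<close>.
\<close>

lemma energy_core_step:
  fixes Y :: "real multiset" and N :: nat and p :: real
  defines "n \<equiv> real N - 1" and "k \<equiv> real N / p - 1"
  assumes p: "0 < p" "p < 1" and N: "N \<ge> 2" and size: "size Y = N - 1"
  defines "C \<equiv> n + (n + 1)\<^sup>2 / (k - n)"
  shows "energy k (core p b (add_mset z Y)) \<le> energy k Y"
    and "energy k (core p b (add_mset z Y)) \<le> energy k Y - (energy k Y / C - (z - sum_mset Y / k)\<^sup>2)"
proof -
  let ?X = "add_mset z Y"
  define e where "e = extreme_point p b ?X"
  define c where "c = p_centre p ?X"
  have n: "real (size Y) = n" "n > 0" using size N by (auto simp: n_def)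
  have "real N < real N / p" using p N by (simp add: field_simps)
  then have k: "n < k" by (simp add: n_def k_def)
  then have k0: "k > 0" using n by linarith
  have N0: "real N > 0" using N by simp
  have c: "c = sum_mset ?X / (k + 1)"
    using p N size by (simp add: c_def p_centre_def mean_mset_def k_def)
  have e: "e \<in># ?X" unfolding e_def by (rule extreme_point_in) simp
  have far: "\<bar>x - c\<bar> \<le> \<bar>e - c\<bar>" if "x \<in># ?X" for x
    using extreme_point_farthest[of ?X p b] that
    by (auto simp: farthest_points_def e_def c_def dist_real_def)
  have eq: "energy k (core p b ?X) = energy k Y - (k + 1) / k * ((e - c)\<^sup>2 - (z - c)\<^sup>2)"
    unfolding core_def using energy_exchange[OF k0 _ c, of e] e by (simp add: e_def)
  have d: "0 \<le> (e - c)\<^sup>2 - (z - c)\<^sup>2"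
    using far[of z] by (simp add: abs_le_square_iff)
  then show "energy k (core p b ?X) \<le> energy k Y"
    using k0 by (simp add: eq)
  have C0: "C > 0"
    using n k by (simp add: C_def add_pos_nonneg)
  have "energy k Y \<le> C * (e - c)\<^sup>2"
    using energy_le_farthest[of Y k c z "\<bar>e - c\<bar>"] k c far by (simp add: n C_def)
  then have far_e: "energy k Y / C \<le> (e - c)\<^sup>2"
    using C0 by (simp add: field_simps)
  have closer: "(z - c)\<^sup>2 \<le> (z - sum_mset Y / k)\<^sup>2"
  proof -
    have "z - c = k / (k + 1) * (z - sum_mset Y / k)"
    proof -
      have "(k + 1) * c = sum_mset Y + z" using k0 by (simp add: c)
      then have "(k + 1) * (z - c) = k * (z - sum_mset Y / k)"
        using k0 by (simp add: algebra_simps)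
      then show ?thesis using k0 by (simp add: eq_divide_eq mult.commute)
    qed
    then have "\<bar>z - c\<bar> = k / (k + 1) * \<bar>z - sum_mset Y / k\<bar>"
      using k0 by (simp add: abs_mult)
    also have "\<dots> \<le> 1 * \<bar>z - sum_mset Y / k\<bar>"
      using k0 by (intro mult_right_mono) auto
    finally show ?thesis by (simp add: abs_le_square_iff)
  qed
  have "energy k Y / C - (z - sum_mset Y / k)\<^sup>2 \<le> 1 * ((e - c)\<^sup>2 - (z - c)\<^sup>2)"
    using diff_mono[OF far_e closer] by (simp only: mult_1_left)
  also have "\<dots> \<le> (k + 1) / k * ((e - c)\<^sup>2 - (z - c)\<^sup>2)"
    using d k0 by (intro mult_right_mono) auto
  finally show "energy k (core p b ?X) \<le> energy k Y - (energy k Y / C - (z - sum_mset Y / k)\<^sup>2)"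
    unfolding eq by (rule diff_left_mono)
qed

text \<open>
  A positive limit \<open>L\<close> is impossible: once \<open>E\<close> is close enough to \<open>L\<close>, a single drop of about
  \<open>L / C\<close> takes it below \<open>L\<close>.
\<close>

lemma tendsto_zero_if_frequent_proportional_drops:
  fixes E :: "nat \<Rightarrow> real"
  assumes nonneg: "\<And>t. 0 \<le> E t" and dec: "\<And>t. E (Suc t) \<le> E t" and C: "C > 0"
    and drop: "\<And>d. d > 0 \<Longrightarrow> \<exists>\<^sub>\<infinity>t. E (Suc t) \<le> E t - (E t / C - d)"
  shows "E \<longlonglongrightarrow> 0"
proof -
  have dE: "decseq E" by (rule decseq_SucI) (rule dec)
  then obtain L where L: "E \<longlonglongrightarrow> L" "\<And>t. L \<le> E t"
    using decseq_convergent[of E 0] nonneg by blast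
  have "L \<ge> 0" using L(1) nonneg by (simp add: LIMSEQ_le_const)
  moreover have "\<not> L > 0"
  proof
    assume pos: "L > 0"
    \<comment> \<open>Half of the guaranteed drop \<open>L / C\<close> is spent on the error term, half remains.\<close>
    define d where "d = L / C / 2"
    have d: "d > 0" using pos C by (simp add: d_def)
    have "eventually (\<lambda>t. E t < L + d) sequentially"
      using L(1) d by (intro order_tendstoD) auto
    then have "\<exists>\<^sub>\<infinity>t. E (Suc t) \<le> E t - (E t / C - d) \<and> E t < L + d"
      using drop[OF d] by (intro INFM_conjI) (auto simp: cofinite_eq_sequentially)
    then obtain t where t: "E (Suc t) \<le> E t - (E t / C - d)" "E t < L + d"
      by (auto dest: INFM_EX)
    have "2 * d \<le> E t / C"
      using L(2)[of t] C by (simp add: d_def divide_right_mono)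
    then have "E (Suc t) < L" using t by linarith
    then show False using L(2)[of "Suc t"] by linarith
  qed
  ultimately show ?thesis using L(1) by simp
qed

text \<open>
  The deterministic half of the argument: this holds for every sequence of replacements and coins
  along which the hits occur.
\<close>

lemma core_tendsto_zero_if_hits:
  fixes p :: real and N :: nat
  defines "k \<equiv> real N / p - 1"
  assumes p: "0 < p" "p < 1" and N: "N \<ge> 2" and size: "size X = N"
    and hits: "\<And>d. d > 0 \<Longrightarrow>
      \<exists>\<^sub>\<infinity>t. \<bar>z (Suc t) - sum_mset (contest_core p X z b t) / k\<bar> \<le> d"
  shows "core_tendsto N (contest_core p X z b) 0"
proof -
  define Y where "Y = contest_core p X z b"
  define n where "n = real N - 1"
  define C where "C = n + (n + 1)\<^sup>2 / (k - n)"
  have n0: "n > 0" using N by (simp add: n_def)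
  have "real N < real N / p" using p N by (simp add: field_simps)
  then have k: "n < k" by (simp add: n_def k_def)
  have sizeY: "size (Y t) = N - 1" for t
    unfolding Y_def using size_contest_core[OF size] N by simp
  then have sY: "real (size (Y t)) = n" for t
    using N by (simp add: n_def)
  have Suc: "Y (Suc t) = core p (b (Suc t)) (add_mset (z (Suc t)) (Y t))" for t
    by (simp add: Y_def contest_core_def)
  have "(\<lambda>t. energy k (Y t)) \<longlonglongrightarrow> 0"
  proof (rule tendsto_zero_if_frequent_proportional_drops)
    show "0 \<le> energy k (Y t)" for t
      using k by (intro energy_nonneg) (simp add: sY)
    show "energy k (Y (Suc t)) \<le> energy k (Y t)" for t
      unfolding Suc k_def by (rule energy_core_step(1)[OF p N sizeY])
    show "C > 0" using n0 k by (simp add: C_def add_pos_nonneg)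
    fix d :: real assume d: "d > 0"
    have "\<exists>\<^sub>\<infinity>t. \<bar>z (Suc t) - sum_mset (Y t) / k\<bar> \<le> sqrt d"
      using hits[of "sqrt d"] d by (simp add: Y_def)
    then show "\<exists>\<^sub>\<infinity>t. energy k (Y (Suc t)) \<le> energy k (Y t) - (energy k (Y t) / C - d)"
    proof (rule INFM_mono)
      fix t assume "\<bar>z (Suc t) - sum_mset (Y t) / k\<bar> \<le> sqrt d"
      then have "(z (Suc t) - sum_mset (Y t) / k)\<^sup>2 \<le> d"
        using d by (simp add: real_le_rsqrt sqrt_ge_absD)
      then show "energy k (Y (Suc t)) \<le> energy k (Y t) - (energy k (Y t) / C - d)"
        using energy_core_step(2)[OF p N sizeY, of "b (Suc t)" "z (Suc t)" t]
        unfolding Suc k_def C_def n_def by linarith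
    qed
  qed
  then have "(\<lambda>t. sqrt (k / (k - n) * energy k (Y t))) \<longlonglongrightarrow> sqrt (k / (k - n) * 0)"
    by (intro tendsto_intros)
  then have lim: "(\<lambda>t. sqrt (k / (k - n) * energy k (Y t))) \<longlonglongrightarrow> 0" by simp
  show ?thesis
    unfolding core_tendsto_def
  proof
    fix i assume i: "i \<in> {1..N - 1}"
    have "norm (order_stat i (Y t)) \<le> sqrt (k / (k - n) * energy k (Y t))" for t
    proof -
      have "length (sorted_list_of_multiset (Y t)) = N - 1"
        using sizeY[of t] by (metis mset_sorted_list_of_multiset size_mset)
      then have "order_stat i (Y t) \<in> set (sorted_list_of_multiset (Y t))"
        unfolding order_stat_def using i by (intro nth_mem) auto
      then have "(order_stat i (Y t))\<^sup>2 \<le> k / (k - n) * energy k (Y t)"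
        using square_le_energy[of "Y t" k] k by (simp add: sY)
      then show ?thesis by (simp add: real_le_rsqrt)
    qed
    then have "(\<lambda>t. order_stat i (Y t)) \<longlonglongrightarrow> 0"
      by (intro Lim_null_comparison[OF _ lim]) simp
    then show "(\<lambda>t. order_stat i (contest_core p X z b t)) \<longlonglongrightarrow> 0"
      by (simp add: Y_def)
  qed
qed

section \<open>Events that stay possible whatever the past\<close>

text \<open>
  The events \<open>H t\<close> need not be independent; it suffices that \<open>H t\<close> has conditional probability at least
  \<open>q\<close> given the past \<open>G t\<close>. Then the probability of missing \<open>m\<close> of them in a row shrinks
  by the factor \<open>1 - q\<close> with each further event.
\<close>

lemma (in prob_space) infinitely_often_if_conditionally_likely:
  fixes G :: "nat \<Rightarrow> 'a measure" and H :: "nat \<Rightarrow> 'a set"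
  assumes space: "\<And>t. space (G t) = space M"
    and mono: "\<And>t. sets (G t) \<subseteq> sets (G (Suc t))" and sub: "\<And>t. sets (G t) \<subseteq> events"
    and H: "\<And>t. H t \<in> sets (G (Suc t))" and q: "0 < q"
    and likely: "\<And>t A. A \<in> sets (G t) \<Longrightarrow> q * prob A \<le> prob (A \<inter> H t)"
  shows "AE \<omega> in M. \<exists>\<^sub>\<infinity>t. \<omega> \<in> H t"
proof -
  have H': "H t \<in> events" for t using H sub by blast
  define B where "B s m = {\<omega> \<in> space M. \<forall>t\<in>{s..<s + m}. \<omega> \<notin> H t}" for s m
  have BSuc: "B s (Suc m) = B s m - H (s + m)" for s m
    by (auto simp: B_def less_Suc_eq)
  have BG: "B s m \<in> sets (G (s + m))" for s m
  proof (induction m)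
    case 0
    then show ?case using sets.top[of "G s"] by (simp add: B_def space)
  next
    case (Suc m)
    then show ?case using H[of "s + m"] mono[of "s + m"] by (auto simp: BSuc)
  qed
  then have Bev: "B s m \<in> events" for s m using sub by blast
  have "q * prob (space M) \<le> prob (space M \<inter> H 0)"
    by (rule likely) (metis space sets.top)
  also have "\<dots> \<le> 1" by (rule prob_le_1)
  finally have q1: "q \<le> 1" by (simp add: prob_space)
  have Bprob: "prob (B s m) \<le> (1 - q) ^ m" for s m
  proof (induction m)
    case (Suc m)
    have "prob (B s (Suc m)) = prob (B s m) - prob (B s m \<inter> H (s + m))"
      unfolding BSuc using Bev H' by (rule finite_measure_Diff')
    also have "\<dots> \<le> (1 - q) * prob (B s m)"
      using likely[OF BG, of s m] by (simp add: algebra_simps)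
    also have "\<dots> \<le> (1 - q) * (1 - q) ^ m"
      using Suc q1 by (intro mult_left_mono) auto
    finally show ?case by simp
  qed simp
  have "AE \<omega> in M. \<exists>t\<ge>s. \<omega> \<in> H t" for s
  proof -
    define Z where "Z = (\<Inter>m. B s m)"
    have Z: "Z \<in> events" using Bev by (auto simp: Z_def)
    have le: "prob Z \<le> (1 - q) ^ m" for m
    proof -
      have "prob Z \<le> prob (B s m)"
        using Bev by (intro finite_measure_mono) (auto simp: Z_def)
      then show ?thesis using Bprob[of s m] by linarith
    qed
    have "(\<lambda>m. (1 - q) ^ m) \<longlonglongrightarrow> 0"
      using q q1 by (intro LIMSEQ_realpow_zero) auto
    then have "prob Z \<le> 0"
      using le by (intro LIMSEQ_le_const[of _ 0]) auto
    then have "prob Z = 0" by (simp add: measure_le_0_iff)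
    then have "AE \<omega> in M. \<omega> \<notin> Z"
      using Z by (intro AE_not_in) (auto simp: null_sets_def emeasure_eq_measure)
    then show ?thesis
    proof (rule AE_mp, intro AE_I2 impI)
      fix \<omega> assume w: "\<omega> \<in> space M" "\<omega> \<notin> Z"
      then show "\<exists>t\<ge>s. \<omega> \<in> H t" by (auto simp: Z_def B_def)
    qed
  qed
  then have "AE \<omega> in M. \<forall>s. \<exists>t\<ge>s. \<omega> \<in> H t" by (simp add: AE_all_countable)
  then show ?thesis by (simp add: INFM_nat_le)
qed

section \<open>Measurability of the contest\<close>

text \<open>
  The \<open>\<sigma>\<close>-algebra on configurations only counts points, whereas the dynamics need sums and
  comparisons of points. The configurations are therefore enumerated by \<open>N\<close> real random variables,
  built from the order statistics at time \<open>0\<close> and updated in place. For this the extreme point has to be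
  expressed by measurable operations.
\<close>

lemma extreme_point_eq:
  fixes X :: "real multiset" and p :: real
  defines "l \<equiv> Min (set_mset X)" and "u \<equiv> Max (set_mset X)" and "c \<equiv> p_centre p X"
  assumes X: "X \<noteq> {#}"
  shows "extreme_point p b X =
    (if dist u c < dist l c \<or> dist l c = dist u c \<and> b then l else u)"
proof -
  let ?F = "farthest_points p X"
  have sub: "?F \<subseteq> {l, u}" unfolding l_def u_def by (rule farthest_points_subset)
  have ne: "?F \<noteq> {}" using X by (rule farthest_points_nonempty)
  have lu: "l \<in># X" "u \<in># X" "l \<le> u" using X by (auto simp: l_def u_def)
  have mem: "x \<in> ?F \<longleftrightarrow> x \<in># X \<and> (\<forall>y\<in>#X. dist y c \<le> dist x c)" for x
    by (simp add: farthest_points_def c_def)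
  have farthest_iff: "x \<in> ?F \<longleftrightarrow> dist l c \<le> dist x c \<and> dist u c \<le> dist x c" if "x \<in># X" for x
  proof
    assume "x \<in> ?F"
    then show "dist l c \<le> dist x c \<and> dist u c \<le> dist x c" using mem lu by blast
  next
    assume x: "dist l c \<le> dist x c \<and> dist u c \<le> dist x c"
    obtain f where f: "f \<in> ?F" using ne by blast
    then have "dist f c \<le> dist x c" using x sub by auto
    then show "x \<in> ?F" using f mem that by (meson order_trans)
  qed
  have l: "l \<in> ?F \<longleftrightarrow> dist u c \<le> dist l c" and u: "u \<in> ?F \<longleftrightarrow> dist l c \<le> dist u c"
    using farthest_iff[OF lu(1)] farthest_iff[OF lu(2)] by auto
  consider "dist u c < dist l c" | "dist l c < dist u c" | "dist l c = dist u c" by linarith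
  then show ?thesis
  proof cases
    case 1
    then have "?F = {l}" using sub l u by auto
    then show ?thesis using 1 by (simp add: extreme_point_def)
  next
    case 2
    then have "?F = {u}" using sub l u by auto
    then show ?thesis using 2 by (simp add: extreme_point_def)
  next
    case 3
    then have "?F = {l, u}" using sub l u by auto
    then show ?thesis using 3 lu by (simp add: extreme_point_def)
  qed
qed

lemma measurable_extreme_point:
  fixes V :: "nat \<Rightarrow> 'a \<Rightarrow> real"
  assumes V [measurable]: "\<And>i. V i \<in> borel_measurable G"
    and b [measurable]: "b \<in> measurable G (count_space UNIV)" and N: "N > 0"
  shows "(\<lambda>\<omega>. extreme_point p (b \<omega>) (image_mset (\<lambda>i. V i \<omega>) (mset_set {..<N})))
    \<in> borel_measurable G"
proof -
  have ne: "image_mset (\<lambda>i. V i \<omega>) (mset_set {..<N}) \<noteq> {#}" for \<omega>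
    using N by (simp add: mset_set_empty_iff lessThan_empty_iff)
  have s: "set_mset (image_mset (\<lambda>i. V i \<omega>) (mset_set {..<N})) = (\<lambda>i. V i \<omega>) ` {..<N}" for \<omega>
    by simp
  have [measurable]: "(\<lambda>\<omega>. Min ((\<lambda>i. V i \<omega>) ` {..<N})) \<in> borel_measurable G"
    by (rule borel_measurable_Min) auto
  have [measurable]: "(\<lambda>\<omega>. Max ((\<lambda>i. V i \<omega>) ` {..<N})) \<in> borel_measurable G"
    by (rule borel_measurable_Max) auto
  show ?thesis
    unfolding extreme_point_eq[OF ne] s p_centre_def mean_mset_def sum_unfold_sum_mset[symmetric]
      size_image_mset size_mset_set
    by measurable
qed

text \<open>
  Only one copy of a point may be replaced; the first index at which it occurs is a measurable choice.
\<close>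

lemma replace_first_occurrence:
  fixes V :: "nat \<Rightarrow> 'b"
  assumes e: "e \<in> V ` {..<N}"
  shows "image_mset (\<lambda>i. if V i = e \<and> (\<forall>j<i. V j \<noteq> e) then z else V i) (mset_set {..<N})
    = add_mset z (image_mset V (mset_set {..<N}) - {#e#})"
proof -
  let ?W = "\<lambda>i. if V i = e \<and> (\<forall>j<i. V j \<noteq> e) then z else V i"
  define m where "m = (LEAST i. V i = e)"
  obtain i where i: "V i = e" "i < N" using e by auto
  have m: "V m = e" "m < N"
    using i LeastI[of "\<lambda>i. V i = e" i] Least_le[of "\<lambda>i. V i = e" i] by (auto simp: m_def)
  have first: "V j \<noteq> e" if "j < m" for j
    using that not_less_Least[of j "\<lambda>i. V i = e"] by (simp add: m_def)
  have split: "mset_set {..<N} = add_mset m (mset_set ({..<N} - {m}))"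
    using m by (simp add: mset_set.remove)
  have "?W m = z" using m first by simp
  moreover have "image_mset ?W (mset_set ({..<N} - {m})) = image_mset V (mset_set ({..<N} - {m}))"
  proof (rule image_mset_cong)
    fix i assume "i \<in># mset_set ({..<N} - {m})"
    then have "i \<noteq> m" by simp
    then show "?W i = V i"
      using m(1) first by (metis linorder_neqE_nat)
  qed
  ultimately show ?thesis using m by (simp add: split)
qed

text \<open>
  The link between order statistics and counting: the event that an order statistic is at most \<open>a\<close>
  says how many points lie in \<open>{..a}\<close>.
\<close>

lemma less_length_filter_sorted_iff:
  fixes xs :: "'b::linorder list"
  assumes "sorted xs" and "i < length xs"
  shows "i < length (filter (\<lambda>x. x \<le> a) xs) \<longleftrightarrow> xs ! i \<le> a"
  using assms
proof (induction xs arbitrary: i)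
  case (Cons x xs)
  show ?case
  proof (cases "x \<le> a")
    case True
    then show ?thesis using Cons by (cases i) auto
  next
    case False
    then have "filter (\<lambda>y. y \<le> a) (x # xs) = []"
      using Cons.prems(1) by (auto simp: filter_empty_conv)
    moreover have "\<not> (x # xs) ! i \<le> a"
      using False Cons.prems by (cases i) (auto, meson nth_mem order_trans)
    ultimately show ?thesis by simp
  qed
qed simp

text \<open>
  On configurations with too few points \<open>order_stat\<close> reads beyond the end of a list, hence the
  default value \<open>0\<close>.
\<close>

lemma measurable_order_stat:
  "(\<lambda>X. if size X = N then order_stat i X else 0) \<in> borel_measurable mset_algebra"
  if i: "i \<in> {1..N}"
proof (rule borel_measurable_iff_le[THEN iffD2], rule allI)
  fix a :: real
  have gen: "{X. size (filter_mset (\<lambda>x. x \<in> A) X) = n} \<in> sets mset_algebra"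
    if "A \<in> sets borel" for A n
    using that unfolding mset_algebra_def by (intro in_measure_of) auto
  have sp: "space mset_algebra = UNIV"
    by (simp add: mset_algebra_def space_measure_of_conv)
  have size: "{X. size X = N} \<in> sets mset_algebra"
    using gen[of UNIV N] by simp
  have "{X. \<not> size (filter_mset (\<lambda>x. x \<in> {..a}) X) \<le> i - 1}
      = space mset_algebra - (\<Union>n\<in>{..i - 1}. {X. size (filter_mset (\<lambda>x. x \<in> {..a}) X) = n})"
    by (auto simp: sp)
  also have "\<dots> \<in> sets mset_algebra"
    using gen[of "{..a}"] by (intro sets.compl_sets sets.finite_UN) auto
  finally have cnt: "{X. \<not> size (filter_mset (\<lambda>x. x \<in> {..a}) X) \<le> i - 1} \<in> sets mset_algebra" .
  have iff: "order_stat i X \<le> a \<longleftrightarrow> \<not> size (filter_mset (\<lambda>x. x \<in> {..a}) X) \<le> i - 1"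
    if "size X = N" for X
  proof -
    define xs where "xs = sorted_list_of_multiset X"
    have X: "X = mset xs" "sorted xs" by (simp_all add: xs_def)
    have "i - 1 < length xs" using that i X by auto
    then have "i - 1 < length (filter (\<lambda>x. x \<le> a) xs) \<longleftrightarrow> xs ! (i - 1) \<le> a"
      using X by (intro less_length_filter_sorted_iff) auto
    then show ?thesis
      by (simp add: order_stat_def flip: xs_def) (simp add: X(1) not_le flip: mset_filter size_mset)
  qed
  have "{X \<in> space mset_algebra. (if size X = N then order_stat i X else 0) \<le> a}
      = ({X. size X = N} \<inter> {X. \<not> size (filter_mset (\<lambda>x. x \<in> {..a}) X) \<le> i - 1})
        \<union> (if 0 \<le> a then space mset_algebra - {X. size X = N} else {})"
    using iff by (auto simp: sp)
  also have "\<dots> \<in> sets mset_algebra"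
    using size cnt by auto
  finally show "{X \<in> space mset_algebra. (if size X = N then order_stat i X else 0) \<le> a}
    \<in> sets mset_algebra" .
qed

lemma image_order_stat:
  assumes "size X = N"
  shows "image_mset (\<lambda>i. order_stat (Suc i) X) (mset_set {..<N}) = X"
proof -
  define xs where "xs = sorted_list_of_multiset X"
  have X: "X = mset xs" by (simp add: xs_def)
  then have N: "N = length xs" using assms by simp
  have "image_mset (\<lambda>i. xs ! i) (mset_set {..<N}) = mset (map ((!) xs) [0..<length xs])"
    by (simp add: N atLeast0LessThan)
  then show ?thesis by (simp add: order_stat_def map_nth flip: xs_def X)
qed

text \<open>
  Stated for an arbitrary filtration \<open>G\<close> to which the inputs are adapted, \<open>coin t\<close> being known at
  time \<open>t\<close> already, since it decides which point leaves the configuration at time \<open>t\<close>.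
\<close>

lemma contest_measurable_enumeration:
  fixes G :: "nat \<Rightarrow> 'a measure"
  assumes space: "\<And>t. space (G t) = \<Omega>"
    and mono: "\<And>t. sets (G t) \<subseteq> sets (G (Suc t))"
    and X0: "X0 \<in> measurable (G 0) mset_algebra"
    and \<zeta>: "\<And>t. \<zeta> (Suc t) \<in> borel_measurable (G (Suc t))"
    and coin: "\<And>t. coin t \<in> measurable (G t) (count_space UNIV)" and N: "N > 0"
  shows "\<exists>V. (\<forall>i. V i \<in> borel_measurable (G t)) \<and>
    (\<forall>\<omega>. size (X0 \<omega>) = N \<longrightarrow>
      contest p (X0 \<omega>) (\<lambda>t. \<zeta> t \<omega>) (\<lambda>t. coin t \<omega>) t = image_mset (\<lambda>i. V i \<omega>) (mset_set {..<N}))"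
proof (induction t)
  case 0
  define V where "V i \<omega> = (if i < N then if size (X0 \<omega>) = N then order_stat (Suc i) (X0 \<omega>) else 0 else 0)"
    for i \<omega>
  have "V i \<in> borel_measurable (G 0)" for i
  proof (cases "i < N")
    case True
    then show ?thesis
      using measurable_compose[OF X0 measurable_order_stat[of "Suc i" N]] by (simp add: V_def[abs_def])
  qed (simp add: V_def[abs_def])
  moreover have "image_mset (\<lambda>i. V i \<omega>) (mset_set {..<N}) = X0 \<omega>" if "size (X0 \<omega>) = N" for \<omega>
  proof -
    have "image_mset (\<lambda>i. V i \<omega>) (mset_set {..<N})
        = image_mset (\<lambda>i. order_stat (Suc i) (X0 \<omega>)) (mset_set {..<N})"
      using that by (intro image_mset_cong) (auto simp: V_def)
    then show ?thesis using image_order_stat[OF that] by simp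
  qed
  ultimately show ?case by (intro exI[of _ V]) auto
next
  case (Suc t)
  then obtain V where V: "\<And>i. V i \<in> borel_measurable (G t)"
    and eq: "\<And>\<omega>. size (X0 \<omega>) = N \<Longrightarrow>
      contest p (X0 \<omega>) (\<lambda>t. \<zeta> t \<omega>) (\<lambda>t. coin t \<omega>) t = image_mset (\<lambda>i. V i \<omega>) (mset_set {..<N})"
    by blast
  have subalg: "f \<in> measurable (G (Suc t)) K" if "f \<in> measurable (G t) K" for f and K :: "'c measure"
    using that mono[of t] by (auto simp: measurable_def space)
  define e where "e \<omega> = extreme_point p (coin t \<omega>) (image_mset (\<lambda>i. V i \<omega>) (mset_set {..<N}))" for \<omega>
  define W where "W i \<omega> = (if V i \<omega> = e \<omega> \<and> (\<forall>j<i. V j \<omega> \<noteq> e \<omega>) then \<zeta> (Suc t) \<omega> else V i \<omega>)" for i \<omega>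
  have [measurable]: "V i \<in> borel_measurable (G (Suc t))" for i
    using V by (rule subalg)
  have [measurable]: "e \<in> borel_measurable (G (Suc t))"
    unfolding e_def using V coin N by (intro subalg measurable_extreme_point)
  have [measurable]: "\<zeta> (Suc t) \<in> borel_measurable (G (Suc t))" by (rule \<zeta>)
  have "W i \<in> borel_measurable (G (Suc t))" for i
    unfolding W_def by measurable
  moreover have "contest p (X0 \<omega>) (\<lambda>t. \<zeta> t \<omega>) (\<lambda>t. coin t \<omega>) (Suc t)
      = image_mset (\<lambda>i. W i \<omega>) (mset_set {..<N})" if "size (X0 \<omega>) = N" for \<omega>
  proof -
    have "e \<omega> \<in># image_mset (\<lambda>i. V i \<omega>) (mset_set {..<N})"
      unfolding e_def using N by (intro extreme_point_in) (simp add: mset_set_empty_iff lessThan_empty_iff)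
    then have "e \<omega> \<in> (\<lambda>i. V i \<omega>) ` {..<N}" by simp
    then show ?thesis
      using eq[OF that] unfolding W_def by (simp add: replace_first_occurrence core_def e_def)
  qed
  ultimately show ?case by blast
qed

lemma contest_core_sum_measurable:
  fixes G :: "nat \<Rightarrow> 'a measure"
  assumes space: "\<And>t. space (G t) = \<Omega>"
    and mono: "\<And>t. sets (G t) \<subseteq> sets (G (Suc t))"
    and X0: "X0 \<in> measurable (G 0) mset_algebra"
    and \<zeta>: "\<And>t. \<zeta> (Suc t) \<in> borel_measurable (G (Suc t))"
    and coin: "\<And>t. coin t \<in> measurable (G t) (count_space UNIV)" and N: "N > 0"
  obtains s where "s \<in> borel_measurable (G t)"
    and "\<And>\<omega>. size (X0 \<omega>) = N \<Longrightarrow>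
      s \<omega> = sum_mset (contest_core p (X0 \<omega>) (\<lambda>t. \<zeta> t \<omega>) (\<lambda>t. coin t \<omega>) t)"
proof -
  obtain V where V: "\<And>i. V i \<in> borel_measurable (G t)"
    and eq: "\<And>\<omega>. size (X0 \<omega>) = N \<Longrightarrow>
      contest p (X0 \<omega>) (\<lambda>t. \<zeta> t \<omega>) (\<lambda>t. coin t \<omega>) t = image_mset (\<lambda>i. V i \<omega>) (mset_set {..<N})"
    using contest_measurable_enumeration[of G \<Omega> X0 \<zeta> coin N t p, OF assms] by blast
  define e where "e \<omega> = extreme_point p (coin t \<omega>) (image_mset (\<lambda>i. V i \<omega>) (mset_set {..<N}))" for \<omega>
  have [measurable]: "e \<in> borel_measurable (G t)"
    unfolding e_def using V coin N by (intro measurable_extreme_point)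
  note V [measurable]
  have "(\<lambda>\<omega>. (\<Sum>i<N. V i \<omega>) - e \<omega>) \<in> borel_measurable (G t)" by measurable
  moreover have "(\<Sum>i<N. V i \<omega>) - e \<omega>
      = sum_mset (contest_core p (X0 \<omega>) (\<lambda>t. \<zeta> t \<omega>) (\<lambda>t. coin t \<omega>) t)" if "size (X0 \<omega>) = N" for \<omega>
  proof -
    have "e \<omega> \<in># image_mset (\<lambda>i. V i \<omega>) (mset_set {..<N})"
      unfolding e_def using N by (intro extreme_point_in) (simp add: mset_set_empty_iff lessThan_empty_iff)
    then have "e \<omega> + sum_mset (image_mset (\<lambda>i. V i \<omega>) (mset_set {..<N}) - {#e \<omega>#}) = (\<Sum>i<N. V i \<omega>)"
      by (simp add: sum_mset.remove[symmetric] sum_unfold_sum_mset)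
    then show ?thesis
      by (simp add: contest_core_def eq[OF that] core_def flip: e_def)
  qed
  ultimately show ?thesis by (rule that)
qed

section \<open>Replacements that fall next to the centre of the core\<close>

text \<open>
  The minimum puts the end point \<open>1\<close> into the last of the \<open>J\<close> cells, and gives every real number,
  also outside \<open>[0,1]\<close>, one of finitely many values.
\<close>

definition grid_cell :: "nat \<Rightarrow> real \<Rightarrow> nat" where
  "grid_cell J x = min (nat \<lfloor>real J * x\<rfloor>) (J - 1)"

lemma grid_cell_less: "J > 0 \<Longrightarrow> grid_cell J x < J"
  by (simp add: grid_cell_def min_less_iff_disj)

lemma measurable_grid_cell [measurable]:
  "grid_cell J \<in> measurable borel (count_space UNIV)"
  unfolding grid_cell_def by measurable

lemma grid_cell_bounds:
  assumes "J > 0" and "x \<in> {0..1}"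
  shows "real (grid_cell J x) \<le> real J * x" and "real J * x \<le> real (grid_cell J x) + 1"
proof -
  have "0 \<le> real J * x" "real J * x \<le> real J" using assms by (auto simp: mult_left_le)
  then have "real (nat \<lfloor>real J * x\<rfloor>) \<le> real J * x" "real J * x < real (nat \<lfloor>real J * x\<rfloor>) + 1"
    "real (J - 1) + 1 = real J"
    using assms(1) by linarith+
  then show "real (grid_cell J x) \<le> real J * x" "real J * x \<le> real (grid_cell J x) + 1"
    using \<open>real J * x \<le> real J\<close> by (auto simp: grid_cell_def min_def)
qed

lemma same_grid_cell_close:
  assumes J: "J > 0" and "x \<in> {0..1}" and "y \<in> {0..1}" and "grid_cell J x = grid_cell J y"
  shows "\<bar>x - y\<bar> \<le> 1 / real J"
proof -
  have "\<bar>real J * x - real J * y\<bar> \<le> 1"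
    using grid_cell_bounds[OF assms(1,2)] grid_cell_bounds[OF assms(1,3)] assms(4) by simp
  then have "real J * \<bar>x - y\<bar> \<le> 1"
    by (simp add: abs_mult flip: right_diff_distrib)
  then show ?thesis using J by (simp add: field_simps)
qed

lemma uniform_measure_grid_cell:
  assumes j: "j < J"
  shows "1 / real J \<le> measure (uniform_measure lborel {0..1::real}) {x. grid_cell J x = j}"
proof -
  define I where "I = {real j / real J<..<real (Suc j) / real J}"
  have J: "real J > 0" using j by simp
  have "real (Suc j) \<le> real J" using j by simp
  then have le: "0 \<le> real j / real J" "real j / real J \<le> real (Suc j) / real J" "real (Suc j) / real J \<le> 1"
    using J by (auto simp: field_simps)
  have I01: "I \<subseteq> {0..1}" 
  proof
    fix x assume "x \<in> I"
    then have "real j / real J < x" "x < real (Suc j) / real J" by (simp_all add: I_def)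
    then show "x \<in> {0..1}" using le by (simp only: atLeastAtMost_iff) linarith
  qed
  interpret U: prob_space "uniform_measure lborel {0..1::real}"
    by (rule prob_space_uniform_measure) auto
  have "1 / real J = measure lborel ({0..1} \<inter> I)"
    using I01 le J by (simp add: Int_absorb1 I_def diff_divide_distrib[symmetric])
  also have "\<dots> = U.prob I"
    by (subst measure_uniform_measure) (auto simp: I_def)
  also have "\<dots> \<le> U.prob {x. grid_cell J x = j}"
  proof (rule U.finite_measure_mono)
    show "I \<subseteq> {x. grid_cell J x = j}"
    proof
      fix x assume "x \<in> I"
      then have "real j < real J * x" "real J * x < real j + 1"
        using J by (auto simp: I_def field_simps)
      then have "\<lfloor>real J * x\<rfloor> = int j" by linarith
      then show "x \<in> {x. grid_cell J x = j}" using j by (simp add: grid_cell_def)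
    qed
    have "{x \<in> space borel. grid_cell J x = j} \<in> sets borel" by measurable
    then show "{x. grid_cell J x = j} \<in> sets (uniform_measure lborel {0..1})" by simp
  qed
  finally show ?thesis .
qed

context contest_input
begin

definition source_algebra :: "source \<Rightarrow> 'a set set" where
  "source_algebra s = (case s of
      Initial \<Rightarrow> sets (vimage_algebra (space M) X0 mset_algebra)
    | Replacement t \<Rightarrow> sets (vimage_algebra (space M) (\<zeta> t) borel)
    | Coin t \<Rightarrow> sets (vimage_algebra (space M) (coin t) (count_space UNIV)))"

text \<open>
  All coins are put into the past, the future ones included: this keeps the next replacement
  independent of the past and makes the core at time \<open>t\<close>, which uses \<open>coin t\<close>, measurable.
\<close>

definition past :: "nat \<Rightarrow> source set" where
  "past t = {Initial} \<union> Replacement ` {1..t} \<union> range Coin"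

definition history :: "nat \<Rightarrow> 'a measure" where
  "history t = sigma (space M) (\<Union>s\<in>past t. source_algebra s)"

lemma indep_source_algebra:
  "indep_sets source_algebra ({Initial} \<union> Replacement ` {1..} \<union> range Coin)"
  using indep unfolding source_algebra_def .

lemma source_algebra_Pow: "source_algebra s \<subseteq> Pow (space M)"
proof (cases s)
  case Initial
  then show ?thesis
    using sets.space_closed[of "vimage_algebra (space M) X0 mset_algebra"]
    by (simp add: source_algebra_def)
next
  case (Replacement t)
  then show ?thesis
    using sets.space_closed[of "vimage_algebra (space M) (\<zeta> t) borel"]
    by (simp add: source_algebra_def)
next
  case (Coin t)
  then show ?thesis
    using sets.space_closed[of "vimage_algebra (space M) (coin t) (count_space UNIV)"]
    by (simp add: source_algebra_def)
qed

lemma Int_stable_source_algebra: "Int_stable (source_algebra s)"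
  by (cases s) (auto simp: source_algebra_def Int_stable_def)

lemma space_history [simp]: "space (history t) = space M"
  unfolding history_def using source_algebra_Pow by (intro space_measure_of) blast

lemma sets_history: "sets (history t) = sigma_sets (space M) (\<Union>s\<in>past t. source_algebra s)"
  unfolding history_def using source_algebra_Pow by (intro sets_measure_of) blast

lemma sets_history_mono: "sets (history t) \<subseteq> sets (history (Suc t))"
  unfolding sets_history by (intro sigma_sets_mono') (auto simp: past_def)

lemma sets_history_events: "sets (history t) \<subseteq> events"
proof -
  have "source_algebra s \<subseteq> events" if "s \<in> past t" for s
  proof -
    have "s \<in> {Initial} \<union> Replacement ` {1..} \<union> range Coin"
      using that unfolding past_def by auto
    then show ?thesis
      using indep_source_algebra unfolding indep_sets_def by blast
  qed
  then show ?thesis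
    unfolding sets_history by (intro sets.sigma_sets_subset) blast
qed

lemma measurable_history:
  assumes s: "s \<in> past t" and alg: "source_algebra s = sets (vimage_algebra (space M) f K)"
    and f: "f \<in> measurable M K"
  shows "f \<in> measurable (history t) K"
proof (rule measurableI)
  fix A assume A: "A \<in> sets K"
  then have "f -` A \<inter> space M \<in> source_algebra s"
    unfolding alg using f by (intro in_vimage_algebra) 
  then show "f -` A \<inter> space (history t) \<in> sets (history t)"
    unfolding space_history sets_history using s by blast
next
  fix x assume "x \<in> space (history t)"
  then show "f x \<in> space K" using f by (simp add: measurable_space)
qed

lemma history_indep_next_replacement:
  assumes A: "A \<in> sets (history t)" and B: "B \<in> sets borel"
  shows "prob (A \<inter> (\<zeta> (Suc t) -` B \<inter> space M)) = prob A * measure D B"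
proof -
  let ?I = "case_bool (past t) {Replacement (Suc t)}"
  let ?B = "\<zeta> (Suc t) -` B \<inter> space M"
  have indep2: "indep_sets (\<lambda>j. sigma_sets (space M) (\<Union>i\<in>?I j. source_algebra i)) UNIV"
  proof (rule indep_sets_collect_sigma)
    show "indep_sets source_algebra (\<Union>j. ?I j)"
      by (rule indep_sets_mono_index[OF _ indep_source_algebra])
        (auto simp: past_def split: bool.splits)
    show "disjoint_family ?I"
      by (auto simp: disjoint_family_on_def UNIV_bool past_def)
  qed (rule Int_stable_source_algebra)
  have B': "?B \<in> source_algebra (Replacement (Suc t))"
    
    unfolding source_algebra_def using B by (simp add: in_vimage_algebra)
  have "\<forall>j\<in>UNIV. case_bool A ?B j \<in> sigma_sets (space M) (\<Union>i\<in>?I j. source_algebra i)"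
    using A B' by (simp add: UNIV_bool sets_history sigma_sets.Basic)
  then have "prob (\<Inter>j\<in>UNIV. case_bool A ?B j) = (\<Prod>j\<in>UNIV. prob (case_bool A ?B j))"
    by (intro indep_setsD[OF indep2]) auto
  then have "prob (A \<inter> ?B) = prob A * prob ?B"
    by (simp add: UNIV_bool Int_commute mult.commute)
  also have "prob ?B = measure D B"
    using \<zeta>_measurable[of "Suc t"] \<zeta>_distr[of "Suc t"] B measure_distr[of "\<zeta> (Suc t)" M borel B] by simp
  finally show ?thesis .
qed

text \<open>
  A target cell chosen by the past takes finitely many values, so the event \<open>A\<close> splits into
  finitely many pieces on each of which the target is constant and independence applies.
\<close>

lemma next_replacement_hits_random_cell:
  assumes d: "d \<in> measurable (history t) (count_space UNIV)" and d_less: "\<And>\<omega>. d \<omega> < J"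
    and cells: "\<And>j. j < J \<Longrightarrow> q \<le> measure D {x. grid_cell J x = j}"
    and A: "A \<in> sets (history t)"
  shows "q * prob A \<le> prob (A \<inter> {\<omega> \<in> space M. grid_cell J (\<zeta> (Suc t) \<omega>) = d \<omega>})"
proof -
  let ?H = "{\<omega> \<in> space M. grid_cell J (\<zeta> (Suc t) \<omega>) = d \<omega>}"
  define a where "a j = A \<inter> (d -` {j} \<inter> space M)" for j
  define h where "h j = \<zeta> (Suc t) -` {x. grid_cell J x = j} \<inter> space M" for j
  have a: "a j \<in> sets (history t)" for j
    using measurable_sets[OF d, of "{j}"] A by (auto simp: a_def)
  have cell: "{x. grid_cell J x = j} \<in> sets borel" for j
  proof -
    have "{x \<in> space borel. grid_cell J x = j} \<in> sets borel" by measurable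
    then show ?thesis by simp
  qed
  have h: "h j \<in> events" for j
    unfolding h_def using \<zeta>_measurable[of "Suc t"] cell by (intro measurable_sets) auto
  have AM: "A \<subseteq> space M" using A sets.sets_into_space by fastforce
  have "q * prob A = q * prob (\<Union>j<J. a j)"
  proof -
    have "A = (\<Union>j<J. a j)" using AM d_less by (auto simp: a_def)
    then show ?thesis by simp
  qed
  also have "\<dots> = q * (\<Sum>j<J. prob (a j))"
    using a sets_history_events
    by (subst finite_measure_finite_Union) (auto simp: disjoint_family_on_def a_def)
  also have "\<dots> \<le> (\<Sum>j<J. prob (a j \<inter> h j))"
    unfolding sum_distrib_left
  proof (rule sum_mono)
    fix j assume "j \<in> {..<J}"
    then have "prob (a j) * q \<le> prob (a j) * measure D {x. grid_cell J x = j}"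
      using cells by (intro mult_left_mono) auto
    then show "q * prob (a j) \<le> prob (a j \<inter> h j)"
      unfolding h_def using history_indep_next_replacement[OF a cell] by (simp add: mult.commute)
  qed
  also have "\<dots> = prob (\<Union>j<J. a j \<inter> h j)"
  proof (rule finite_measure_finite_Union[symmetric])
    show "(\<lambda>j. a j \<inter> h j) ` {..<J} \<subseteq> events"
      using a h sets_history_events by blast
    show "disjoint_family_on (\<lambda>j. a j \<inter> h j) {..<J}"
      by (auto simp: disjoint_family_on_def a_def)
  qed simp
  also have "(\<Union>j<J. a j \<inter> h j) = A \<inter> ?H"
    using AM d_less by (auto simp: a_def h_def)
  finally show ?thesis .
qed

text \<open>
  The centre \<open>sum_mset Y / k\<close> of the core lies in \<open>[0,1]\<close> because the core has \<open>N - 1 < k\<close> points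
  of \<open>[0,1]\<close>; hence the replacement can reach its cell.
\<close>

lemma replacements_near_core_centre:
  assumes S: "S = {0..1}" and D: "D = uniform_measure lborel {0..1}" and N: "N > 0"
    and k: "real N - 1 < k" "0 < k" and J: "J > 0"
  shows "AE \<omega> in M. \<exists>\<^sub>\<infinity>t. \<bar>\<zeta> (Suc t) \<omega> -
    sum_mset (contest_core p (X0 \<omega>) (\<lambda>t. \<zeta> t \<omega>) (\<lambda>t. coin t \<omega>) t) / k\<bar> \<le> 1 / real J"
proof -
  let ?Y = "\<lambda>t \<omega>. contest_core p (X0 \<omega>) (\<lambda>t. \<zeta> t \<omega>) (\<lambda>t. coin t \<omega>) t"
  have X0m: "X0 \<in> measurable (history t) mset_algebra" for t
    by (rule measurable_history[of Initial, OF _ _ X0_measurable])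
      (auto simp: past_def source_algebra_def)
  have \<zeta>m: "\<zeta> (Suc t) \<in> borel_measurable (history (Suc t))" for t
    by (rule measurable_history[of "Replacement (Suc t)", OF _ _ \<zeta>_measurable])
      (auto simp: past_def source_algebra_def)
  have coinm: "coin t \<in> measurable (history t) (count_space UNIV)" for t
    by (rule measurable_history[of "Coin t", OF _ _ coin_measurable])
      (auto simp: past_def source_algebra_def)
  have "\<exists>s. s \<in> borel_measurable (history t) \<and>
      (\<forall>\<omega>. size (X0 \<omega>) = N \<longrightarrow> s \<omega> = sum_mset (?Y t \<omega>))" for t
    using contest_core_sum_measurable[of history "space M" X0 \<zeta> coin N t p,
      OF space_history sets_history_mono X0m \<zeta>m coinm N] by blast
  then obtain s where s: "\<And>t. s t \<in> borel_measurable (history t)"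
    and s_eq: "\<And>t \<omega>. size (X0 \<omega>) = N \<Longrightarrow> s t \<omega> = sum_mset (?Y t \<omega>)"
    by metis
  \<comment> \<open>Off the null event \<open>size (X0 \<omega>) \<noteq> N\<close> this is the cell of the centre of the core.\<close>
  define d where "d t \<omega> = grid_cell J (s t \<omega> / k)" for t \<omega>
  have dm: "d t \<in> measurable (history t) (count_space UNIV)" for t
    unfolding d_def using s[of t] by measurable
  define H where "H t = {\<omega> \<in> space M. grid_cell J (\<zeta> (Suc t) \<omega>) = d t \<omega>}" for t
  have "AE \<omega> in M. \<exists>\<^sub>\<infinity>t. \<omega> \<in> H t"
  proof (rule infinitely_often_if_conditionally_likely)
    show "sets (history t) \<subseteq> sets (history (Suc t))" for t by (rule sets_history_mono)
    show "sets (history t) \<subseteq> events" for t by (rule sets_history_events)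
    show "H t \<in> sets (history (Suc t))" for t
    proof -
      have [measurable]: "d t \<in> measurable (history (Suc t)) (count_space UNIV)"
        using dm[of t] sets_history_mono[of t] by (auto simp: measurable_def)
      note \<zeta>m[of t, measurable]
      \<comment> \<open>Comparing the cells as real numbers turns the event into an equality of Borel functions.\<close>
      have "{\<omega> \<in> space (history (Suc t)). real (grid_cell J (\<zeta> (Suc t) \<omega>)) = real (d t \<omega>)} \<in> sets (history (Suc t))"
        by measurable
      then show ?thesis by (simp add: H_def)
    qed
    show "0 < 1 / real J" using J by simp
    show "1 / real J * prob A \<le> prob (A \<inter> H t)" if "A \<in> sets (history t)" for t A
      unfolding H_def using dm _ _ that
    proof (rule next_replacement_hits_random_cell)
      show "d t \<omega> < J" for \<omega> unfolding d_def using J by (rule grid_cell_less)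
      show "1 / real J \<le> measure D {x. grid_cell J x = j}" if "j < J" for j
        unfolding D using that by (rule uniform_measure_grid_cell)
    qed
  qed simp
  moreover have "AE \<omega> in M. \<forall>t\<in>{1..}. \<zeta> t \<omega> \<in> {0..1}"
  proof -
    have "AE \<omega> in M. \<zeta> t \<omega> \<in> {0..1}" if t: "t \<ge> 1" for t
    proof -
      have "AE x in distr M borel (\<zeta> t). x \<in> {0..1}"
        unfolding \<zeta>_distr[OF t] D by (rule AE_uniform_measureI) auto
      then show ?thesis
        using AE_distrD[OF \<zeta>_measurable[OF t]] by blast
    qed
    then show ?thesis by (subst AE_ball_countable) auto
  qed
  ultimately show ?thesis
    using X0_size X0_range
  proof eventually_elim
    case (elim \<omega>)
    have range: "\<zeta> (Suc t) \<omega> \<in> {0..1}" for t using elim(2) by simp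
    have close: "\<bar>\<zeta> (Suc t) \<omega> - sum_mset (?Y t \<omega>) / k\<bar> \<le> 1 / real J" if "\<omega> \<in> H t" for t
    proof -
      have "set_mset (contest p (X0 \<omega>) (\<lambda>t. \<zeta> t \<omega>) (\<lambda>t. coin t \<omega>) t) \<subseteq> {0..1}"
        using elim(2,4) by (intro contest_range) (auto simp: S)
      then have Y01: "set_mset (?Y t \<omega>) \<subseteq> {0..1}"
        by (auto simp: contest_core_def core_def dest: in_diffD)
      have "(\<Sum>x\<in>#?Y t \<omega>. 0) \<le> (\<Sum>x\<in>#?Y t \<omega>. x)"
        using Y01 by (intro sum_mset_mono) auto
      moreover have "(\<Sum>x\<in>#?Y t \<omega>. x) \<le> (\<Sum>x\<in>#?Y t \<omega>. 1)"
        using Y01 by (intro sum_mset_mono) auto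
      moreover have "real (size (?Y t \<omega>)) \<le> k"
        using size_contest_core[OF elim(3) N] k N by (simp add: of_nat_diff)
      ultimately have "sum_mset (?Y t \<omega>) / k \<in> {0..1}" using k by (simp add: field_simps)
      then show ?thesis
        using that s_eq[OF elim(3), of t] range[of t] J
        by (intro same_grid_cell_close) (auto simp: H_def d_def)
    qed
    show ?case using elim(1) close by (rule INFM_mono)
  qed
qed

end

theorem theorem1:
  fixes M :: "'a measure" and N :: nat and p :: real
    and X0 :: "'a \<Rightarrow> real multiset" and \<zeta> :: "nat \<Rightarrow> 'a \<Rightarrow> real" and coin :: "nat \<Rightarrow> 'a \<Rightarrow> bool"
  assumes "N \<ge> 3" and "0 < p" and "p < 1"
    and "contest_input M N {0..1} (uniform_measure lborel {0..1}) X0 \<zeta> coin"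
  shows "AE \<omega> in M.
           core_tendsto N (contest_core p (X0 \<omega>) (\<lambda>t. \<zeta> t \<omega>) (\<lambda>t. coin t \<omega>)) 0"
proof -
  interpret contest_input M N "{0..1}" "uniform_measure lborel {0..1}" X0 \<zeta> coin
    by (rule assms(4))
  define k where "k = real N / p - 1"
  have "real N < real N / p" using assms(1-3) by (simp add: field_simps)
  then have k: "real N - 1 < k" "0 < k" using assms(1) by (auto simp: k_def)
  let ?near = "\<lambda>\<omega> r t. \<bar>\<zeta> (Suc t) \<omega> -
    sum_mset (contest_core p (X0 \<omega>) (\<lambda>t. \<zeta> t \<omega>) (\<lambda>t. coin t \<omega>) t) / k\<bar> \<le> r"
  have "AE \<omega> in M. \<exists>\<^sub>\<infinity>t. ?near \<omega> (1 / real (Suc J)) t" for J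
    using assms(1) k by (intro replacements_near_core_centre) auto
  then have "AE \<omega> in M. \<forall>J. \<exists>\<^sub>\<infinity>t. ?near \<omega> (1 / real (Suc J)) t"
    by (simp only: AE_all_countable) blast
  then show ?thesis
    using X0_size
  proof eventually_elim
    case (elim \<omega>)
    show ?case
    proof (rule core_tendsto_zero_if_hits[OF assms(2,3) _ elim(2)])
      show "N \<ge> 2" using assms(1) by simp
      fix r :: real assume "r > 0"
      then obtain J where J: "1 / real (Suc J) < r" using nat_approx_posE by blast
      have "\<exists>\<^sub>\<infinity>t. ?near \<omega> (1 / real (Suc J)) t" using elim(1) by blast
      then have "\<exists>\<^sub>\<infinity>t. ?near \<omega> r t" by (rule INFM_mono) (use J in linarith)
      then show "\<exists>\<^sub>\<infinity>t. \<bar>\<zeta> (Suc t) \<omega> - sum_mset (contest_core p (X0 \<omega>)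
          (\<lambda>t. \<zeta> t \<omega>) (\<lambda>t. coin t \<omega>) t) / (real N / p - 1)\<bar> \<le> r"
        by (simp only: k_def)
    qed
  qed
qed

end
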